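(* Let $c>0$ and fix $\theta=(\theta^{(1)},\theta^{(2)},\dots)\in\prod_{n\in\mathbb{N}}\mathbb{S}^{n-1}$, where $\mathbb{S}^{n-1}$ is the Euclidean unit sphere of $\mathbb{R}^n$ and $\theta^{(n)}=(\theta^{(n)}_1,\dots,\theta^{(n)}_n)\in\mathbb{S}^{n-1}$, such that $$\lim_{n\to\infty}\sqrt{\frac{n}{\log n}}\ \max_{1\le i\le n}\theta^{(n)}_i=c .$$ For each $n$ let $X^{(n,1)}=(X^{(n,1)}_1,\dots,X^{(n,1)}_n)$ be uniformly distributed on the unit $\ell^1$ ball $\mathbb{B}_{n,1}$ of $\mathbb{R}^n$, and set $W^{(n,1)}_\theta:=n^{1/2}\sum_{i=1}^nX^{(n,1)}_i\theta^{(n)}_i$. Then $(W^{(n,1)}_\theta)_{n\in\mathbb{N}}$ satisfies a large deviation principle with speed $n/\sqrt{\log n}$ and the good rate function $\mathbb{I}^{\mathsf{qu}}_{1,c}(w):=\frac{|w|}{c}$, $w\in\mathbb{R}$.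
   Context: $\mathbb{B}_{n,1}=\{x\in\mathbb{R}^n:\sum_{i=1}^n|x_i|\le 1\}$. Large deviation principle (LDP): a sequence $(\xi_n)$ of random variables in a topological space $\Sigma$ satisfies an LDP with speed $s(n)$ and rate function $I:\Sigma\to[0,\infty]$ if $I$ is lower semi-continuous and for all Borel $\Gamma\subset\Sigma$, $-\inf_{\Gamma^\circ}I\le\liminf_n\frac{1}{s(n)}\log\mathbb{P}(\xi_n\in\Gamma^\circ)\le\limsup_n\frac1{s(n)}\log\mathbb{P}(\xi_n\in\bar\Gamma)\le-\inf_{\bar\Gamma}I$, where $\Gamma^\circ$ and $\bar\Gamma$ are the interior and closure of $\Gamma$. $I$ is good if its level sets $\{x\in\Sigma: I(x)\le a\}$, $a<\infty$, are compact. Here $\Sigma=\mathbb{R}$.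
   Formalization: The hypothesis on the maximum of the coordinates of θ^(n) is taken with max |θ_i^(n)| instead of the signed max θ_i^(n), since with the signed maximum a large negative coordinate (e.g. θ_1 = −1/2) makes the claim false. *)

theory Defs
  imports "HOL-Probability.Probability"
begin

(* Points of R^n are functions on {1..n}, extended by undefined elsewhere, so that they
   form the space of the finite product measure "PiM {1..n} (\<lambda>_. lborel)", which is
   Lebesgue measure on R^n. *)

definition unit_sphere :: "nat \<Rightarrow> (nat \<Rightarrow> real) set" where
  "unit_sphere n = {x \<in> {1..n} \<rightarrow>\<^sub>E UNIV. L2_set x {1..n} = 1}"

definition l1_ball :: "nat \<Rightarrow> (nat \<Rightarrow> real) set" where
  "l1_ball n = {x \<in> {1..n} \<rightarrow>\<^sub>E UNIV. (\<Sum>i = 1..n. \<bar>x i\<bar>) \<le> 1}"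

definition uniform_on_l1_ball ::
    "nat \<Rightarrow> 'a measure \<Rightarrow> ('a \<Rightarrow> nat \<Rightarrow> real) \<Rightarrow> bool" where
  "uniform_on_l1_ball n M X \<longleftrightarrow>
     X \<in> M \<rightarrow>\<^sub>M PiM {1..n} (\<lambda>_. lborel) \<and>
     distr M (PiM {1..n} (\<lambda>_. lborel)) X
       = uniform_measure (PiM {1..n} (\<lambda>_. lborel)) (l1_ball n)"

(* The size of a direction is measured by the largest modulus of its coordinates; for
   coordinatewise nonnegative directions this is the largest coordinate. The signed maximum
   would not do: the law of the uniform distribution on l1_ball is invariant under sign
   changes of coordinates, so large negative coordinates of a direction matter as much as
   large positive ones. *)
definition max_abs_coord :: "nat \<Rightarrow> (nat \<Rightarrow> real) \<Rightarrow> real" where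
  "max_abs_coord n x = (MAX i\<in>{1..n}. \<bar>x i\<bar>)"

definition W_proj ::
    "(nat \<Rightarrow> nat \<Rightarrow> real) \<Rightarrow> (nat \<Rightarrow> 'a \<Rightarrow> nat \<Rightarrow> real) \<Rightarrow> nat \<Rightarrow> 'a \<Rightarrow> real" where
  "W_proj \<theta> X n \<omega> = sqrt (real n) * (\<Sum>i = 1..n. X n \<omega> i * \<theta> n i)"

(* Logarithm of a probability, with log 0 = - \<infinity>; the real function ln has ln 0 = 0. *)
definition ln_prob :: "real \<Rightarrow> ereal" where
  "ln_prob p = (if p = 0 then - \<infinity> else ereal (ln p))"

definition lower_semicont :: "('b::topological_space \<Rightarrow> ereal) \<Rightarrow> bool" where
  "lower_semicont I \<longleftrightarrow> (\<forall>a. closed {x. I x \<le> a})"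

(* Sequences are indexed by n \<ge> 1; the n-th random variable lives on its own probability
   space M n. *)
definition satisfies_LDP ::
    "(nat \<Rightarrow> 'a measure) \<Rightarrow> (nat \<Rightarrow> 'a \<Rightarrow> 'b::topological_space) \<Rightarrow> (nat \<Rightarrow> real) \<Rightarrow>
     ('b \<Rightarrow> ereal) \<Rightarrow> bool" where
  "satisfies_LDP M \<xi> s I \<longleftrightarrow>
     (\<forall>n\<ge>1. prob_space (M n) \<and> \<xi> n \<in> borel_measurable (M n)) \<and>
     (\<forall>x. 0 \<le> I x) \<and> lower_semicont I \<and>
     (\<forall>\<Gamma>\<in>sets borel.
        - (INF x\<in>interior \<Gamma>. I x)
          \<le> liminf (\<lambda>n. ereal (1 / s n) * ln_prob \<P>(\<omega> in M n. \<xi> n \<omega> \<in> interior \<Gamma>)) \<and>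
        liminf (\<lambda>n. ereal (1 / s n) * ln_prob \<P>(\<omega> in M n. \<xi> n \<omega> \<in> interior \<Gamma>))
          \<le> limsup (\<lambda>n. ereal (1 / s n) * ln_prob \<P>(\<omega> in M n. \<xi> n \<omega> \<in> closure \<Gamma>)) \<and>
        limsup (\<lambda>n. ereal (1 / s n) * ln_prob \<P>(\<omega> in M n. \<xi> n \<omega> \<in> closure \<Gamma>))
          \<le> - (INF x\<in>closure \<Gamma>. I x))"

definition good_rate :: "('b::topological_space \<Rightarrow> ereal) \<Rightarrow> bool" where
  "good_rate I \<longleftrightarrow> (\<forall>a::real. compact {x. I x \<le> ereal a})"

definition I_qu :: "real \<Rightarrow> real \<Rightarrow> ereal" where
  "I_qu c w = ereal (\<bar>w\<bar> / c)"

end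

theory Submission
  imports Defs "HOL-Real_Asymp.Real_Asymp"
begin

text \<open>
  For the upper bound, the indicator of \<open>{|x|\<^sub>1 \<le> 1, \<langle>x, \<theta>\<rangle> \<ge> t}\<close> is dominated by
  \<open>exp (n (1 - |x|\<^sub>1) + n s (\<langle>x, \<theta>\<rangle> - t))\<close>, whose integral is a product of two-sided Laplace integrals.
  Dividing by the volume \<open>2\<^sup>n / n!\<close> of the ball leaves at most
  \<open>e n exp (- n s t) \<Prod> 1 / (1 - s\<^sup>2 \<theta>\<^sub>i\<^sup>2)\<close>, and since \<open>|\<theta>|\<^sub>2 = 1\<close> the product is at most
  \<open>exp (s\<^sup>2 / d)\<close> when \<open>s = (1 - d) / max |\<theta>\<^sub>i|\<close>; this factor is negligible at the given speed.
  For the lower bound, a single coordinate of maximal weight produces the deviation: the remaining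
  coordinates contribute a nonnegative amount on half of the volume by the symmetry \<open>x \<mapsto> - x\<close>, which
  gives \<open>P (\<langle>X, \<theta>\<rangle> \<ge> y max |\<theta>\<^sub>i|) \<ge> (1 - y)\<^sup>n / 4\<close>. Subtracting the upper bound for a slightly
  larger deviation localises this estimate to short intervals.
\<close>

section \<open>Volumes in the unit ball of the 1-norm\<close>

abbreviation lebesgue_prod :: "'i set \<Rightarrow> ('i \<Rightarrow> real) measure" where
  "lebesgue_prod I \<equiv> PiM I (\<lambda>_. lborel)"

section \<open>One-dimensional integrals\<close>

lemma product_sigma_finite_lborel: "product_sigma_finite (\<lambda>_. lborel :: real measure)"
  by standard

lemma nn_integral_lborel_fold:
  fixes f :: "real \<Rightarrow> ennreal"
  assumes [measurable]: "f \<in> borel_measurable borel"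
  shows "(\<integral>\<^sup>+x. f x \<partial>lborel) = (\<integral>\<^sup>+x. (f x + f (- x)) * indicator {0..} x \<partial>lborel)"
proof -
  have "(\<integral>\<^sup>+x. f x \<partial>lborel)
      = (\<integral>\<^sup>+x. f x * indicator {0..} x + f x * indicator {..<0} x \<partial>lborel)"
    by (intro nn_integral_cong) (auto split: split_indicator)
  also have "\<dots> = (\<integral>\<^sup>+x. f x * indicator {0..} x \<partial>lborel) + (\<integral>\<^sup>+x. f x * indicator {..<0} x \<partial>lborel)"
    by (rule nn_integral_add) auto
  also have "(\<integral>\<^sup>+x. f x * indicator {..<0} x \<partial>lborel)
      = (\<integral>\<^sup>+x. f (- x) * indicator {..<0} (- x) \<partial>lborel)"
    by (subst nn_integral_real_affine[of _ "-1" 0]) auto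
  \<comment> \<open>The reflected indicator is that of the open half-line, so the two integrands
    differ only at the null point 0.\<close>
  also have "\<dots> = (\<integral>\<^sup>+x. f (- x) * indicator {0..} x \<partial>lborel)"
  proof (rule nn_integral_cong_AE)
    have "AE x in lborel. x \<noteq> (0::real)"
      by (rule AE_lborel_singleton)
    then show "AE x in lborel. f (- x) * indicator {..<0} (- x) = f (- x) * indicator {0..} x"
      by eventually_elim (auto split: split_indicator)
  qed
  also have "(\<integral>\<^sup>+x. f x * indicator {0..} x \<partial>lborel) + (\<integral>\<^sup>+x. f (- x) * indicator {0..} x \<partial>lborel)
      = (\<integral>\<^sup>+x. f x * indicator {0..} x + f (- x) * indicator {0..} x \<partial>lborel)"
    by (rule nn_integral_add[symmetric]) auto
  finally show ?thesis
    by (simp add: distrib_right)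
qed

lemma nn_integral_exp_halfline:
  fixes k :: real
  assumes "0 < k"
  shows "(\<integral>\<^sup>+x. ennreal (exp (- k * x)) * indicator {0..} x \<partial>lborel) = ennreal (1 / k)"
proof -
  have "((\<lambda>x. - exp (- k * x) / k) \<longlongrightarrow> - 0 / k) at_top"
    using assms
    by (intro tendsto_intros filterlim_compose[OF exp_at_bot])
       (auto simp: filterlim_uminus_at_bot intro!: filterlim_tendsto_pos_mult_at_top[OF tendsto_const] filterlim_ident)
  then have "(\<integral>\<^sup>+x. ennreal (exp (- k * x)) * indicator {0..} x \<partial>lborel)
      = ennreal (0 - (- exp (- k * 0) / k))"
    using assms
    by (intro nn_integral_FTC_atLeast) (auto intro!: derivative_eq_intros)
  then show ?thesis by simp
qed

text \<open>Folding at 0 leaves two exponentials with rates \<open>a - b\<close> and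
  \<open>a + b\<close>; the hypothesis makes both decay, and partial fractions combine their
  integrals.\<close>

lemma nn_integral_two_sided_exp:
  fixes a b :: real
  assumes "\<bar>b\<bar> < a"
  shows "(\<integral>\<^sup>+x. ennreal (exp (b * x - a * \<bar>x\<bar>)) \<partial>lborel) = ennreal (2 * a / (a\<^sup>2 - b\<^sup>2))"
proof -
  have ab: "0 < a - b" "0 < a + b" using assms by auto
  have "(\<integral>\<^sup>+x. ennreal (exp (b * x - a * \<bar>x\<bar>)) \<partial>lborel)
      = (\<integral>\<^sup>+x. ennreal (exp (- (a - b) * x)) * indicator {0..} x
             + ennreal (exp (- (a + b) * x)) * indicator {0..} x \<partial>lborel)"
    by (subst nn_integral_lborel_fold, simp, intro nn_integral_cong)
       (auto split: split_indicator simp: algebra_simps)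
  also have "\<dots> = ennreal (1 / (a - b)) + ennreal (1 / (a + b))"
    by (subst nn_integral_add, simp, simp)
       (simp only: nn_integral_exp_halfline[OF ab(1)] nn_integral_exp_halfline[OF ab(2)])
  also have "\<dots> = ennreal (1 / (a - b) + 1 / (a + b))"
    using ab by (intro ennreal_plus[symmetric]) auto
  also have "1 / (a - b) + 1 / (a + b) = 2 * a / (a\<^sup>2 - b\<^sup>2)"
    using ab by (simp add: field_simps power2_eq_square)
  finally show ?thesis .
qed

text \<open>The integrand is the volume of a \<open>k\<close>-dimensional 1-norm ball of radius
  \<open>r - u\<close>, that is, of a slice of a ball one dimension higher. The whole ball uses
  \<open>y = 0\<close>; a cap cut off at height \<open>y\<close> uses \<open>y > 0\<close>.\<close>

lemma nn_integral_tent: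
  fixes r y :: real
  assumes "y \<le> r"
  shows "(\<integral>\<^sup>+u. ennreal ((2 * (r - u)) ^ k / fact k) * indicator {y..r} u \<partial>lborel)
       = ennreal (2 ^ k * (r - y) ^ Suc k / fact (Suc k))"
proof -
  let ?F = "\<lambda>u. - (2 ^ k * (r - u) ^ Suc k / fact (Suc k)) :: real"
  have "(\<integral>\<^sup>+u. ennreal ((2 * (r - u)) ^ k / fact k) * indicator {y..r} u \<partial>lborel)
      = ennreal (?F r - ?F y)"
  proof (rule nn_integral_FTC_Icc)
    fix u assume u: "u \<in> {y..r}"
    have "2 ^ k * (real (Suc k) * (r - u) ^ k) / fact (Suc k) = (2 * (r - u)) ^ k / fact k"
      by (simp add: power_mult_distrib fact_Suc del: of_nat_Suc right_diff_distrib_numeral)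
    then show "DERIV ?F u :> (2 * (r - u)) ^ k / fact k"
      by (auto intro!: derivative_eq_intros simp: ac_simps
          simp del: fact_Suc power_Suc of_nat_Suc right_diff_distrib_numeral)
    show "0 \<le> (2 * (r - u)) ^ k / fact k"
      using u by simp
  qed (use assms in auto)
  then show ?thesis by simp
qed

section \<open>Slicing along one coordinate and the volume of the ball\<close>

lemma sum_update_insert:
  fixes f :: "'i \<Rightarrow> real \<Rightarrow> real"
  assumes "finite I" "i \<notin> I"
  shows "(\<Sum>j\<in>insert i I. f j ((x(i := u)) j)) = f i u + (\<Sum>j\<in>I. f j (x j))"
proof -
  have "(\<Sum>j\<in>I. f j ((x(i := u)) j)) = (\<Sum>j\<in>I. f j (x j))"
    using assms by (intro sum.cong) auto
  then show ?thesis using assms by simp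
qed

text \<open>Fubini with the new coordinate outermost. Phrasing it with a predicate exposes each
  slice as \<open>P (x(i := u))\<close>, ready for \<open>sum_update_insert\<close>.\<close>

lemma emeasure_lebesgue_prod_insert:
  assumes "finite I" "i \<notin> I"
    and P: "{x \<in> space (lebesgue_prod (insert i I)). P x} \<in> sets (lebesgue_prod (insert i I))"
  shows "emeasure (lebesgue_prod (insert i I)) {x \<in> space (lebesgue_prod (insert i I)). P x}
       = (\<integral>\<^sup>+u. emeasure (lebesgue_prod I) {x \<in> space (lebesgue_prod I). P (x(i := u))} \<partial>lborel)"
proof -
  interpret product_sigma_finite "\<lambda>_. lborel :: real measure"
    by (rule product_sigma_finite_lborel)
  let ?S = "{x \<in> space (lebesgue_prod (insert i I)). P x}"
  have "emeasure (lebesgue_prod (insert i I)) ?S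
      = (\<integral>\<^sup>+u. (\<integral>\<^sup>+x. indicator ?S (x(i := u)) \<partial>lebesgue_prod I) \<partial>lborel)"
    using assms
    by (subst nn_integral_indicator[OF P, symmetric], subst product_nn_integral_insert_rev) auto
  also have "\<dots> = (\<integral>\<^sup>+u. emeasure (lebesgue_prod I) {x \<in> space (lebesgue_prod I). P (x(i := u))} \<partial>lborel)"
  proof (rule nn_integral_cong)
    fix u :: real
    have meas: "(\<lambda>x. x(i := u)) \<in> lebesgue_prod I \<rightarrow>\<^sub>M lebesgue_prod (insert i I)"
      by (rule measurable_fun_upd[where J = I]) auto
    have eq: "(\<lambda>x. x(i := u)) -` ?S \<inter> space (lebesgue_prod I)
        = {x \<in> space (lebesgue_prod I). P (x(i := u))}"
      using measurable_space[OF meas] by auto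
    have "{x \<in> space (lebesgue_prod I). P (x(i := u))} \<in> sets (lebesgue_prod I)"
      using measurable_sets[OF meas P] unfolding eq .
    then have "emeasure (lebesgue_prod I) {x \<in> space (lebesgue_prod I). P (x(i := u))}
        = (\<integral>\<^sup>+x. indicator {x \<in> space (lebesgue_prod I). P (x(i := u))} x \<partial>lebesgue_prod I)"
      by simp
    also have "\<dots> = (\<integral>\<^sup>+x. indicator ?S (x(i := u)) \<partial>lebesgue_prod I)"
      using eq by (intro nn_integral_cong) (auto split: split_indicator)
    finally show "(\<integral>\<^sup>+x. indicator ?S (x(i := u)) \<partial>lebesgue_prod I)
        = emeasure (lebesgue_prod I) {x \<in> space (lebesgue_prod I). P (x(i := u))}" ..
  qed
  finally show ?thesis .
qed

text \<open>Induction on the coordinates with the radius kept general: the slice at height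
  \<open>u\<close> is a ball of radius \<open>r - \<bar>u\<bar>\<close>, empty once
  \<open>\<bar>u\<bar> > r\<close>. Folding at 0 then reduces the outer integral to
  \<open>nn_integral_tent\<close>.\<close>

lemma emeasure_l1_ball:
  assumes "finite I" "0 \<le> r"
  shows "emeasure (lebesgue_prod I) {x \<in> space (lebesgue_prod I). (\<Sum>i\<in>I. \<bar>x i\<bar>) \<le> r}
       = ennreal ((2 * r) ^ card I / fact (card I))"
  using assms
proof (induction I arbitrary: r rule: finite_induct)
  case empty
  interpret product_sigma_finite "\<lambda>_. lborel :: real measure"
    by (rule product_sigma_finite_lborel)
  show ?case using empty by (simp add: space_PiM_empty emeasure_PiM_empty)
next
  case (insert i I)
  define g where "g u = ennreal ((2 * (r - u)) ^ card I / fact (card I))" for u :: real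
  have [measurable]: "g \<in> borel_measurable borel" unfolding g_def by measurable
  let ?V = "\<lambda>u. g \<bar>u\<bar> * indicator {-r..r} u"
  have "emeasure (lebesgue_prod (insert i I))
          {x \<in> space (lebesgue_prod (insert i I)). (\<Sum>j\<in>insert i I. \<bar>x j\<bar>) \<le> r}
      = (\<integral>\<^sup>+u. ?V u \<partial>lborel)"
  proof (subst emeasure_lebesgue_prod_insert[OF insert.hyps(1,2)], measurable, rule nn_integral_cong)
    fix u :: real
    have eq: "{x \<in> space (lebesgue_prod I). (\<Sum>j\<in>insert i I. \<bar>(x(i := u)) j\<bar>) \<le> r}
        = {x \<in> space (lebesgue_prod I). (\<Sum>j\<in>I. \<bar>x j\<bar>) \<le> r - \<bar>u\<bar>}"
      by (simp only: sum_update_insert[OF insert.hyps(1,2), of "\<lambda>_ v. \<bar>v\<bar>"])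
         (simp add: algebra_simps)
    show "emeasure (lebesgue_prod I) {x \<in> space (lebesgue_prod I). (\<Sum>j\<in>insert i I. \<bar>(x(i := u)) j\<bar>) \<le> r} = ?V u"
    proof (cases "\<bar>u\<bar> \<le> r")
      case True
      then show ?thesis unfolding eq g_def by (subst insert.IH) (auto simp: abs_le_iff)
    next
      case False
      then have empty: "{x \<in> space (lebesgue_prod I). (\<Sum>j\<in>I. \<bar>x j\<bar>) \<le> r - \<bar>u\<bar>} = {}"
        by (auto simp: not_le intro!: less_le_trans[OF _ sum_nonneg])
      show ?thesis
        unfolding eq empty using False by (auto simp: abs_le_iff split: split_indicator)
    qed
  qed
  also have "\<dots> = (\<integral>\<^sup>+u. 2 * (g u * indicator {0..r} u) \<partial>lborel)"
    using insert.prems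
    by (subst nn_integral_lborel_fold, measurable, intro nn_integral_cong)
       (auto split: split_indicator simp: mult_2)
  also have "\<dots> = 2 * ennreal (2 ^ card I * (r - 0) ^ Suc (card I) / fact (Suc (card I)))"
    using insert.prems by (subst nn_integral_cmult, measurable) (simp only: g_def nn_integral_tent)
  also have "\<dots> = ennreal (2 * (2 ^ card I * (r - 0) ^ Suc (card I) / fact (Suc (card I))))"
    using insert.prems by (subst ennreal_mult) auto
  also have "2 * (2 ^ card I * (r - 0) ^ Suc (card I) / fact (Suc (card I)))
      = (2 * r) ^ card (insert i I) / fact (card (insert i I))"
    using insert.hyps by (simp add: power_mult_distrib)
  finally show ?case .
qed

section \<open>Reflection symmetry and the lower volume bound\<close>

lemma distr_lebesgue_prod_uminus:
  assumes "finite I"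
  shows "distr (lebesgue_prod I) (lebesgue_prod I) (\<lambda>x. \<lambda>i\<in>I. - x i) = lebesgue_prod I"
proof -
  interpret product_sigma_finite "\<lambda>_. lborel :: real measure"
    by (rule product_sigma_finite_lborel)
  show ?thesis
  proof (rule PiM_eqI[OF assms])
    fix A :: "'a \<Rightarrow> real set"
    assume A: "\<And>i. i \<in> I \<Longrightarrow> A i \<in> sets lborel"
    have meas: "(\<lambda>x. \<lambda>i\<in>I. - x i) \<in> lebesgue_prod I \<rightarrow>\<^sub>M lebesgue_prod I"
      by measurable
    have "(\<lambda>x. \<lambda>i\<in>I. - x i) -` Pi\<^sub>E I A \<inter> space (lebesgue_prod I) = Pi\<^sub>E I (\<lambda>i. uminus -` A i)"
      by (auto simp: space_PiM PiE_def Pi_def)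
    moreover have "uminus -` A i \<in> sets lborel" if "i \<in> I" for i
      using measurable_sets[of uminus borel borel "A i"] A[OF that] by simp
    moreover have "emeasure lborel (uminus -` A i) = emeasure lborel (A i)" if "i \<in> I" for i
      using A[OF that] emeasure_distr[of uminus lborel borel "A i"]
      by (simp add: lborel_distr_uminus)
    ultimately show "emeasure (distr (lebesgue_prod I) (lebesgue_prod I) (\<lambda>x. \<lambda>i\<in>I. - x i)) (Pi\<^sub>E I A)
        = (\<Prod>i\<in>I. emeasure lborel (A i))"
      using A assms meas by (simp add: emeasure_distr emeasure_PiM sets_PiM_I_finite)
  qed simp
qed

lemma ennreal_half_le:
  assumes "ennreal v \<le> 2 * e"
  shows "ennreal (v / 2) \<le> e"
proof (cases e rule: ennreal_cases)
  case (real h)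
  have "2 * ennreal h = ennreal (2 * h)"
    using real(1) by (simp add: ennreal_mult)
  with assms real have "ennreal v \<le> ennreal (2 * h)" by metis
  then have "v \<le> 2 * h" using real(1) by (simp add: ennreal_le_iff)
  then show ?thesis unfolding real(2) by (intro ennreal_leI) simp
qed simp

text \<open>The ball is covered by this half and its mirror image under
  \<open>x \<mapsto> - x\<close>. Both have the same volume, so each has at least half of the
  total.\<close>

lemma emeasure_l1_ball_halfspace:
  fixes \<theta> :: "'i \<Rightarrow> real"
  assumes "finite I" "0 \<le> r"
  shows "ennreal ((2 * r) ^ card I / fact (card I) / 2)
       \<le> emeasure (lebesgue_prod I)
            {x \<in> space (lebesgue_prod I). (\<Sum>i\<in>I. \<bar>x i\<bar>) \<le> r \<and> 0 \<le> (\<Sum>i\<in>I. x i * \<theta> i)}"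
    (is "_ \<le> emeasure _ ?H")
proof -
  let ?N = "lebesgue_prod I"
  let ?B = "{x \<in> space ?N. (\<Sum>i\<in>I. \<bar>x i\<bar>) \<le> r}"
  let ?H' = "{x \<in> space ?N. (\<Sum>i\<in>I. \<bar>x i\<bar>) \<le> r \<and> (\<Sum>i\<in>I. x i * \<theta> i) \<le> 0}"
  let ?v = "(2 * r) ^ card I / fact (card I)"
  have [measurable]: "?H \<in> sets ?N" "?H' \<in> sets ?N" by measurable
  have "emeasure ?N ?H' = emeasure (distr ?N ?N (\<lambda>x. \<lambda>i\<in>I. - x i)) ?H'"
    by (simp add: distr_lebesgue_prod_uminus assms)
  also have "\<dots> = emeasure ?N ((\<lambda>x. \<lambda>i\<in>I. - x i) -` ?H' \<inter> space ?N)"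
    by (rule emeasure_distr) measurable
  also have "(\<lambda>x. \<lambda>i\<in>I. - x i) -` ?H' \<inter> space ?N = ?H"
    by (auto simp: space_PiM sum_negf)
  finally have eq: "emeasure ?N ?H' = emeasure ?N ?H" .
  have "ennreal ?v = emeasure ?N ?B"
    using emeasure_l1_ball[OF assms] ..
  also have "?B = ?H \<union> ?H'" by auto
  also have "emeasure ?N (?H \<union> ?H') \<le> emeasure ?N ?H + emeasure ?N ?H'"
    by (rule emeasure_subadditive) auto
  finally have *: "ennreal ?v \<le> 2 * emeasure ?N ?H"
    unfolding eq mult_2[symmetric] .
  show ?thesis
    using ennreal_half_le[OF *] .
qed

text \<open>Keep only the points whose \<open>i\<close>-th coordinate has the sign of
  \<open>\<theta> i\<close> and modulus at least \<open>y\<close>, and whose other coordinates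
  contribute a nonnegative sum. The sign restriction and the half-ball bound each cost a factor 2,
  hence the 4.\<close>

lemma emeasure_l1_ball_tail_lower:
  fixes \<theta> :: "'i \<Rightarrow> real"
  assumes "finite I" "i \<notin> I" "0 \<le> y" "y \<le> 1"
  shows "ennreal ((2 * (1 - y)) ^ Suc (card I) / fact (Suc (card I)) / 4)
       \<le> emeasure (lebesgue_prod (insert i I)) {x \<in> space (lebesgue_prod (insert i I)).
            (\<Sum>j\<in>insert i I. \<bar>x j\<bar>) \<le> 1 \<and> y * \<bar>\<theta> i\<bar> \<le> (\<Sum>j\<in>insert i I. x j * \<theta> j)}"
proof -
  \<comment> \<open>Unlike \<open>sgn\<close>, this sign is nonzero also when
    \<open>\<theta> i = 0\<close>, so \<open>u \<mapsto> \<sigma> * u\<close> is always a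
    measure-preserving substitution.\<close>
  define \<sigma> :: real where "\<sigma> = (if 0 \<le> \<theta> i then 1 else - 1)"
  have \<sigma>: "\<sigma> \<noteq> 0" "\<bar>\<sigma>\<bar> = 1" "\<theta> i = \<sigma> * \<bar>\<theta> i\<bar>" by (auto simp: \<sigma>_def)
  define g where "g u = ennreal ((2 * (1 - u)) ^ card I / fact (card I))" for u :: real
  have [measurable]: "g \<in> borel_measurable borel" unfolding g_def by measurable
  let ?h = "\<lambda>u. ennreal (1 / 2) * (g u * indicator {y..1} u)"
  have "(2 * (1 - y)) ^ Suc (card I) = 2 * (2 ^ card I * (1 - y) ^ Suc (card I))"
    by (simp only: power_mult_distrib power_Suc ac_simps)
  then have "(2 * (1 - y)) ^ Suc (card I) / fact (Suc (card I)) / 4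
      = 1 / 2 * (2 ^ card I * (1 - y) ^ Suc (card I) / fact (Suc (card I)))"
    by (simp del: power_Suc fact_Suc)
  then have "ennreal ((2 * (1 - y)) ^ Suc (card I) / fact (Suc (card I)) / 4)
      = ennreal (1 / 2) * ennreal (2 ^ card I * (1 - y) ^ Suc (card I) / fact (Suc (card I)))"
    by (simp only: ennreal_mult'[symmetric] zero_le_divide_1_iff zero_le_numeral)
  also have "\<dots> = (\<integral>\<^sup>+u. ?h u \<partial>lborel)"
    using assms by (subst nn_integral_cmult, measurable) (simp only: g_def nn_integral_tent)
  also have "\<dots> = (\<integral>\<^sup>+u. ?h (\<sigma> * u) \<partial>lborel)"
  proof -
    have "?h \<in> borel_measurable borel" by measurable
    from nn_integral_real_affine[OF this \<sigma>(1), of 0] show ?thesis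
      using \<sigma>(2) by simp
  qed
  also have "\<dots> \<le> (\<integral>\<^sup>+u. emeasure (lebesgue_prod I) {x \<in> space (lebesgue_prod I).
      (\<Sum>j\<in>insert i I. \<bar>(x(i := u)) j\<bar>) \<le> 1 \<and>
      y * \<bar>\<theta> i\<bar> \<le> (\<Sum>j\<in>insert i I. (x(i := u)) j * \<theta> j)} \<partial>lborel)"
  proof (rule nn_integral_mono)
    fix u :: real
    let ?S = "{x \<in> space (lebesgue_prod I). (\<Sum>j\<in>insert i I. \<bar>(x(i := u)) j\<bar>) \<le> 1 \<and>
      y * \<bar>\<theta> i\<bar> \<le> (\<Sum>j\<in>insert i I. (x(i := u)) j * \<theta> j)}"
    have S: "?S = {x \<in> space (lebesgue_prod I). \<bar>u\<bar> + (\<Sum>j\<in>I. \<bar>x j\<bar>) \<le> 1 \<and>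
      y * \<bar>\<theta> i\<bar> \<le> u * \<theta> i + (\<Sum>j\<in>I. x j * \<theta> j)}"
      by (simp only: sum_update_insert[OF assms(1,2), of "\<lambda>_ v. \<bar>v\<bar>"]
            sum_update_insert[OF assms(1,2), of "\<lambda>j v. v * \<theta> j"])
    show "?h (\<sigma> * u) \<le> emeasure (lebesgue_prod I) ?S"
    proof (cases "\<sigma> * u \<in> {y..1}")
      case True
      have abs_u: "\<bar>u\<bar> = \<sigma> * u"
        using True assms \<sigma> by (metis abs_mult abs_of_nonneg atLeastAtMost_iff mult_1 order_trans)
      have "y * \<bar>\<theta> i\<bar> \<le> (\<sigma> * u) * \<bar>\<theta> i\<bar>"
        using True by (intro mult_right_mono) auto
      also have "\<dots> = u * \<theta> i"
        using \<sigma>(3) by (metis mult.assoc mult.commute)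
      finally have ge: "y * \<bar>\<theta> i\<bar> \<le> u * \<theta> i" .
      have "?h (\<sigma> * u) = ennreal (1 / 2) * g (\<sigma> * u)"
        using True by simp
      also have "\<dots> = ennreal (1 / 2 * ((2 * (1 - \<sigma> * u)) ^ card I / fact (card I)))"
        unfolding g_def by (rule ennreal_mult'[symmetric]) simp
      also have "1 / 2 * ((2 * (1 - \<sigma> * u)) ^ card I / fact (card I))
          = (2 * (1 - \<sigma> * u)) ^ card I / fact (card I) / 2"
        by simp
      also have "\<dots> \<le> emeasure (lebesgue_prod I) {x \<in> space (lebesgue_prod I).
          (\<Sum>j\<in>I. \<bar>x j\<bar>) \<le> 1 - \<sigma> * u \<and> 0 \<le> (\<Sum>j\<in>I. x j * \<theta> j)}"
        using True assms by (intro emeasure_l1_ball_halfspace) auto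
      also have "\<dots> \<le> emeasure (lebesgue_prod I) ?S"
      proof (rule emeasure_mono)
        show "{x \<in> space (lebesgue_prod I).
          (\<Sum>j\<in>I. \<bar>x j\<bar>) \<le> 1 - \<sigma> * u \<and> 0 \<le> (\<Sum>j\<in>I. x j * \<theta> j)} \<subseteq> ?S"
          unfolding S using ge abs_u by auto
        show "?S \<in> sets (lebesgue_prod I)"
          unfolding S by measurable
      qed
      finally show ?thesis .
    qed simp
  qed
  also have "\<dots> = emeasure (lebesgue_prod (insert i I)) {x \<in> space (lebesgue_prod (insert i I)).
            (\<Sum>j\<in>insert i I. \<bar>x j\<bar>) \<le> 1 \<and> y * \<bar>\<theta> i\<bar> \<le> (\<Sum>j\<in>insert i I. x j * \<theta> j)}"
    using assms(1,2) by (subst emeasure_lebesgue_prod_insert) auto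
  finally show ?thesis .
qed

text \<open>The exponential weight dominating the indicator factorises over the coordinates, so its
  integral is a product of one-dimensional Laplace integrals. The strict bound on
  \<open>l * \<bar>\<theta> i\<bar>\<close> is what makes each of them finite.\<close>

lemma emeasure_l1_ball_tail_upper:
  fixes \<theta> :: "'i \<Rightarrow> real"
  assumes "finite I" "0 \<le> l" and a: "\<And>i. i \<in> I \<Longrightarrow> l * \<bar>\<theta> i\<bar> < a" "0 \<le> a"
  shows "emeasure (lebesgue_prod I)
           {x \<in> space (lebesgue_prod I). (\<Sum>i\<in>I. \<bar>x i\<bar>) \<le> 1 \<and> t \<le> (\<Sum>i\<in>I. x i * \<theta> i)}
       \<le> ennreal (exp (a - l * t) * (\<Prod>i\<in>I. 2 * a / (a\<^sup>2 - (l * \<theta> i)\<^sup>2)))"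
    (is "emeasure ?N ?S \<le> _")
proof -
  interpret product_sigma_finite "\<lambda>_. lborel :: real measure"
    by (rule product_sigma_finite_lborel)
  let ?f = "\<lambda>i x. exp (l * \<theta> i * x - a * \<bar>x\<bar>)"
  have [measurable]: "?S \<in> sets ?N" by measurable
  have bd: "\<bar>l * \<theta> i\<bar> < a" if "i \<in> I" for i
    using a(1)[OF that] assms(2) by (simp add: abs_mult)
  have "emeasure ?N ?S = (\<integral>\<^sup>+x. indicator ?S x \<partial>?N)" by simp
  also have "\<dots> \<le> (\<integral>\<^sup>+x. ennreal (exp (a - l * t)) * (\<Prod>i\<in>I. ennreal (?f i (x i))) \<partial>?N)"
  proof (rule nn_integral_mono)
    fix x
    \<comment> \<open>Chernoff: both constraints make an exponent \<open>a * (1 - |x|) + l * (\<langle>x, \<theta>\<rangle> - t)\<close> nonnegative.\<close>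
    have "ennreal (exp (a - l * t)) * (\<Prod>i\<in>I. ennreal (?f i (x i)))
        = ennreal (exp (a - l * t + (\<Sum>i\<in>I. l * \<theta> i * x i - a * \<bar>x i\<bar>)))"
      using assms(1) by (simp add: exp_add exp_sum prod_ennreal ennreal_mult prod_nonneg)
    also have "a - l * t + (\<Sum>i\<in>I. l * \<theta> i * x i - a * \<bar>x i\<bar>)
        = a * (1 - (\<Sum>i\<in>I. \<bar>x i\<bar>)) + l * ((\<Sum>i\<in>I. x i * \<theta> i) - t)"
      by (simp add: sum_subtractf sum_distrib_left algebra_simps)
    finally have eq: "ennreal (exp (a - l * t)) * (\<Prod>i\<in>I. ennreal (?f i (x i)))
        = ennreal (exp (a * (1 - (\<Sum>i\<in>I. \<bar>x i\<bar>)) + l * ((\<Sum>i\<in>I. x i * \<theta> i) - t)))" .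
    show "indicator ?S x \<le> ennreal (exp (a - l * t)) * (\<Prod>i\<in>I. ennreal (?f i (x i)))"
      unfolding eq using assms(2) a(2)
      by (auto split: split_indicator intro!: add_nonneg_nonneg mult_nonneg_nonneg)
  qed
  also have "\<dots> = ennreal (exp (a - l * t)) * (\<Prod>i\<in>I. \<integral>\<^sup>+x. ennreal (?f i x) \<partial>lborel)"
    using assms(1) by (subst nn_integral_cmult, measurable) (subst product_nn_integral_prod, auto)
  also have "(\<Prod>i\<in>I. \<integral>\<^sup>+x. ennreal (?f i x) \<partial>lborel) = (\<Prod>i\<in>I. ennreal (2 * a / (a\<^sup>2 - (l * \<theta> i)\<^sup>2)))"
    by (intro prod.cong refl nn_integral_two_sided_exp bd)
  also have "\<dots> = ennreal (\<Prod>i\<in>I. 2 * a / (a\<^sup>2 - (l * \<theta> i)\<^sup>2))"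
    using bd a(2) by (intro prod_ennreal) (force intro!: divide_nonneg_nonneg dest: abs_le_square_iff[THEN iffD1, rotated] simp: abs_le_square_iff[symmetric] less_imp_le)
  finally show ?thesis by (simp add: ennreal_mult')
qed

section \<open>Tail bounds for fixed dimension\<close>

text \<open>A crude Stirling bound, enough to turn the normalising constant into a polynomial
  factor. The induction step amounts to \<open>exp 1 \<le> ((n + 1) / n) ^ (n + 1)\<close>, which
  comes from \<open>1 - 1 / (n + 1) \<le> exp (- 1 / (n + 1))\<close>.\<close>

lemma fact_mult_exp_le:
  assumes "1 \<le> n"
  shows "fact n * exp (real n) \<le> exp 1 * real n ^ Suc n"
  using assms
proof (induction n rule: dec_induct)
  case base
  show ?case by simp
next
  case (step n)
  have n: "0 < real n" using step by simp
  have "real n / real (Suc n) = 1 + - (1 / real (Suc n))"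
    by (simp add: field_simps)
  also have "\<dots> \<le> exp (- (1 / real (Suc n)))"
    by (rule exp_ge_add_one_self)
  finally have "exp (1 / real (Suc n)) \<le> real (Suc n) / real n"
    using n by (simp add: exp_minus field_simps del: of_nat_Suc)
  then have "exp (1 / real (Suc n)) ^ Suc n \<le> (real (Suc n) / real n) ^ Suc n"
    by (intro power_mono) auto
  also have "exp (1 / real (Suc n)) ^ Suc n = exp 1"
    by (subst exp_of_nat_mult[symmetric]) simp
  finally have *: "real n ^ Suc n * exp 1 \<le> real (Suc n) ^ Suc n"
    using n by (simp only: power_divide pos_le_divide_eq zero_less_power mult.commute)
  have "fact (Suc n) * exp (real (Suc n)) = real (Suc n) * exp 1 * (fact n * exp (real n))"
    by (simp add: exp_add[symmetric] algebra_simps)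
  also have "\<dots> \<le> real (Suc n) * exp 1 * (exp 1 * real n ^ Suc n)"
    using step.IH by (intro mult_left_mono) auto
  also have "\<dots> = real (Suc n) * exp 1 * (real n ^ Suc n * exp 1)"
    by simp
  also have "\<dots> \<le> real (Suc n) * exp 1 * real (Suc n) ^ Suc n"
    using * by (intro mult_left_mono) auto
  also have "\<dots> = exp 1 * real (Suc n) ^ Suc (Suc n)"
    by (simp only: power_Suc ac_simps)
  finally show ?case .
qed

text \<open>Used twice: with a fixed gap \<open>d\<close> it turns the product of Laplace factors
  into the exponential of a sum of squares, and with \<open>d = 1 - x\<close> it bounds
  \<open>1 - x\<close> from below.\<close>

lemma inverse_one_minus_le_exp:
  fixes x d :: real
  assumes "0 \<le> x" "0 < d" "d \<le> 1 - x"
  shows "1 / (1 - x) \<le> exp (x / d)"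
proof -
  have "1 / (1 - x) = 1 + x / (1 - x)"
    using assms by (simp add: field_simps)
  also have "\<dots> \<le> 1 + x / d"
    using assms by (intro add_left_mono divide_left_mono) auto
  also have "\<dots> \<le> exp (x / d)"
    by (rule exp_ge_add_one_self)
  finally show ?thesis .
qed

section \<open>From the uniform law to volume ratios\<close>

lemma l1_ball_eq: "l1_ball n = {x \<in> space (lebesgue_prod {1..n}). (\<Sum>i\<in>{1..n}. \<bar>x i\<bar>) \<le> 1}"
  by (auto simp: l1_ball_def space_PiM)

lemma emeasure_l1_ball_1_to_n:
  "emeasure (lebesgue_prod {1..n}) (l1_ball n) = ennreal (2 ^ n / fact n)"
  unfolding l1_ball_eq using emeasure_l1_ball[of "{1..n}" 1] by simp

lemma measure_uniform_on_l1_ball: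
  assumes X: "uniform_on_l1_ball n M X"
    and Q: "{x \<in> space (lebesgue_prod {1..n}). Q x} \<in> sets (lebesgue_prod {1..n})"
  shows "measure M {\<omega> \<in> space M. Q (X \<omega>)}
       = measure (lebesgue_prod {1..n})
           {x \<in> space (lebesgue_prod {1..n}). (\<Sum>i\<in>{1..n}. \<bar>x i\<bar>) \<le> 1 \<and> Q x} / (2 ^ n / fact n)"
proof -
  let ?N = "lebesgue_prod {1..n}"
  let ?Q = "{x \<in> space ?N. Q x}"
  have meas: "X \<in> M \<rightarrow>\<^sub>M ?N" and distr: "distr M ?N X = uniform_measure ?N (l1_ball n)"
    using X by (auto simp: uniform_on_l1_ball_def)
  have "{\<omega> \<in> space M. Q (X \<omega>)} = X -` ?Q \<inter> space M"
    using measurable_space[OF meas] by auto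
  then have "measure M {\<omega> \<in> space M. Q (X \<omega>)} = measure (uniform_measure ?N (l1_ball n)) ?Q"
    unfolding distr[symmetric] by (simp only: measure_distr[OF meas Q])
  also have "\<dots> = measure ?N (l1_ball n \<inter> ?Q) / measure ?N (l1_ball n)"
    by (rule measure_uniform_measure) (simp_all add: emeasure_l1_ball_1_to_n Q del: One_nat_def)
  also have "measure ?N (l1_ball n) = 2 ^ n / fact n"
    by (simp add: measure_def emeasure_l1_ball_1_to_n del: One_nat_def)
  also have "l1_ball n \<inter> ?Q = {x \<in> space ?N. (\<Sum>i\<in>{1..n}. \<bar>x i\<bar>) \<le> 1 \<and> Q x}"
    unfolding l1_ball_eq by auto
  finally show ?thesis .
qed

text \<open>The Chernoff bound with \<open>a = n\<close> and \<open>l = n * s\<close>. The gap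
  \<open>d\<close> keeps every \<open>(s * v i)\<^sup>2\<close> away from 1, so the product costs
  only \<open>exp (s\<^sup>2 / d)\<close> as the squares of \<open>v\<close> sum to at most
  1.\<close>

lemma prob_tail_upper:
  fixes v :: "nat \<Rightarrow> real"
  assumes X: "uniform_on_l1_ball n M X" and n: "1 \<le> n"
    and v: "(\<Sum>i\<in>{1..n}. (v i)\<^sup>2) \<le> 1" and s: "0 \<le> s" and d: "0 < d"
    and sv: "\<And>i. i \<in> {1..n} \<Longrightarrow> (s * v i)\<^sup>2 \<le> 1 - d"
  shows "measure M {\<omega> \<in> space M. t \<le> (\<Sum>i\<in>{1..n}. X \<omega> i * v i)}
       \<le> exp 1 * real n * exp (s\<^sup>2 / d - real n * s * t)"
proof -
  let ?N = "lebesgue_prod {1..n}"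
  let ?S = "{x \<in> space ?N. (\<Sum>i\<in>{1..n}. \<bar>x i\<bar>) \<le> 1 \<and> t \<le> (\<Sum>i\<in>{1..n}. x i * v i)}"
  define P where "P = (\<Prod>i\<in>{1..n}. 1 / (1 - (s * v i)\<^sup>2))"
  have n0: "0 < real n" using n by simp
  have lt: "(s * v i)\<^sup>2 < 1" if "i \<in> {1..n}" for i
    using sv[OF that] d by linarith
  have P0: "0 \<le> P"
    unfolding P_def using lt by (intro prod_nonneg) (auto simp: less_imp_le)
  have "P \<le> (\<Prod>i\<in>{1..n}. exp ((s * v i)\<^sup>2 / d))"
    unfolding P_def using lt sv d
    by (intro prod_mono conjI inverse_one_minus_le_exp) (auto simp: less_imp_le algebra_simps)
  also have "\<dots> = exp (s\<^sup>2 / d * (\<Sum>i\<in>{1..n}. (v i)\<^sup>2))"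
    by (simp add: exp_sum power_mult_distrib sum_distrib_left)
  also have "\<dots> \<le> exp (s\<^sup>2 / d * 1)"
    using v d unfolding exp_le_cancel_iff by (intro mult_left_mono) auto
  finally have P: "P \<le> exp (s\<^sup>2 / d)" by simp
  have "(\<Prod>i\<in>{1..n}. 2 * real n / ((real n)\<^sup>2 - (real n * s * v i)\<^sup>2))
      = (\<Prod>i\<in>{1..n}. 2 / real n * (1 / (1 - (s * v i)\<^sup>2)))"
  proof (intro prod.cong refl)
    fix i assume "i \<in> {1..n}"
    have "(real n)\<^sup>2 - (real n * s * v i)\<^sup>2 = (real n)\<^sup>2 * (1 - (s * v i)\<^sup>2)"
      by (simp add: power_mult_distrib algebra_simps)
    then show "2 * real n / ((real n)\<^sup>2 - (real n * s * v i)\<^sup>2) = 2 / real n * (1 / (1 - (s * v i)\<^sup>2))"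
      using n0 by (simp add: power2_eq_square)
  qed
  also have "\<dots> = (2 / real n) ^ n * P"
    unfolding P_def by (subst prod.distrib) simp
  finally have prod_eq: "(\<Prod>i\<in>{1..n}. 2 * real n / ((real n)\<^sup>2 - (real n * s * v i)\<^sup>2)) = (2 / real n) ^ n * P" .
  have bd: "real n * s * \<bar>v i\<bar> < real n" if "i \<in> {1..n}" for i
  proof -
    have "\<bar>s * v i\<bar> < 1" using lt[OF that] by (simp add: abs_square_less_1)
    then have "s * \<bar>v i\<bar> < 1" using s by (simp add: abs_mult)
    then show ?thesis using n0 by (simp add: mult.assoc)
  qed
  have "emeasure ?N ?S \<le> ennreal (exp (real n - real n * s * t) * ((2 / real n) ^ n * P))"
    using emeasure_l1_ball_tail_upper[of "{1..n}" "real n * s" v "real n" t] bd s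
    unfolding prod_eq by simp
  then have S: "measure ?N ?S \<le> exp (real n - real n * s * t) * ((2 / real n) ^ n * P)"
    unfolding measure_def using P0 n0 by (intro enn2real_leI) auto
  have "measure M {\<omega> \<in> space M. t \<le> (\<Sum>i\<in>{1..n}. X \<omega> i * v i)} = measure ?N ?S / (2 ^ n / fact n)"
    by (rule measure_uniform_on_l1_ball[OF X]) measurable
  also have "\<dots> \<le> exp (real n - real n * s * t) * ((2 / real n) ^ n * P) / (2 ^ n / fact n)"
    using S by (intro divide_right_mono) auto
  \<comment> \<open>Dividing \<open>(2 / n) ^ n\<close> by the volume of the ball leaves
    \<open>fact n / n ^ n\<close>; together with \<open>exp n\<close> this is at most
    \<open>exp 1 * n\<close> by \<open>fact_mult_exp_le\<close>.\<close>
  also have "\<dots> = (fact n * exp (real n)) * (exp (- (real n * s * t)) * P / real n ^ n)"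
    using n0 by (simp add: power_divide exp_diff exp_minus field_simps)
  also have "\<dots> \<le> (exp 1 * real n ^ Suc n) * (exp (- (real n * s * t)) * P / real n ^ n)"
    using fact_mult_exp_le[OF n] P0 by (intro mult_right_mono) auto
  also have "\<dots> = exp 1 * real n * (exp (- (real n * s * t)) * P)"
    using n0 by (simp add: field_simps)
  also have "\<dots> \<le> exp 1 * real n * (exp (- (real n * s * t)) * exp (s\<^sup>2 / d))"
    using P by (intro mult_left_mono) auto
  also have "\<dots> = exp 1 * real n * exp (s\<^sup>2 / d - real n * s * t)"
    by (simp add: exp_add[symmetric])
  finally show ?thesis .
qed

lemma prob_tail_lower:
  fixes v :: "nat \<Rightarrow> real"
  assumes X: "uniform_on_l1_ball n M X" and i: "i \<in> {1..n}" and y: "0 \<le> y" "y \<le> 1"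
  shows "(1 - y) ^ n / 4 \<le> measure M {\<omega> \<in> space M. y * \<bar>v i\<bar> \<le> (\<Sum>j\<in>{1..n}. X \<omega> j * v j)}"
proof -
  let ?N = "lebesgue_prod {1..n}"
  let ?S = "{x \<in> space ?N. (\<Sum>j\<in>{1..n}. \<bar>x j\<bar>) \<le> 1 \<and> y * \<bar>v i\<bar> \<le> (\<Sum>j\<in>{1..n}. x j * v j)}"
  have ins: "insert i ({1..n} - {i}) = {1..n}" and card: "Suc (card ({1..n} - {i})) = n"
    using i by auto
  have "?S \<subseteq> l1_ball n" unfolding l1_ball_eq by auto
  then have "emeasure ?N ?S \<le> emeasure ?N (l1_ball n)"
    by (rule emeasure_mono) (simp add: l1_ball_eq)
  \<comment> \<open>Finiteness is needed to pass from \<open>emeasure\<close> to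
    \<open>measure\<close>.\<close>
  then have fin: "emeasure ?N ?S \<noteq> top"
    by (auto simp: emeasure_l1_ball_1_to_n top_unique simp del: One_nat_def)
  have "ennreal ((2 * (1 - y)) ^ n / fact n / 4) \<le> emeasure ?N ?S"
    using emeasure_l1_ball_tail_lower[of "{1..n} - {i}" i y v] y unfolding ins card by simp
  then have "(2 * (1 - y)) ^ n / fact n / 4 \<le> measure ?N ?S"
    using y by (simp only: emeasure_eq_ennreal_measure[OF fin] ennreal_le_iff measure_nonneg)
  then have "(2 * (1 - y)) ^ n / fact n / 4 / (2 ^ n / fact n) \<le> measure ?N ?S / (2 ^ n / fact n)"
    by (intro divide_right_mono) auto
  also have "measure ?N ?S / (2 ^ n / fact n)
      = measure M {\<omega> \<in> space M. y * \<bar>v i\<bar> \<le> (\<Sum>j\<in>{1..n}. X \<omega> j * v j)}"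
    by (rule measure_uniform_on_l1_ball[OF X, symmetric]) measurable
  also have "(2 * (1 - y)) ^ n / fact n / 4 / (2 ^ n / fact n) = (1 - y) ^ n / 4"
    unfolding power_mult_distrib by (simp del: right_diff_distrib_numeral)
  finally show ?thesis .
qed

section \<open>Logarithmic asymptotics\<close>

text \<open>At \<open>n = 0\<close> and \<open>n = 1\<close> the denominator is 0 and so is the
  value; only large \<open>n\<close> matter for the limits.\<close>

abbreviation ldp_speed :: "nat \<Rightarrow> real" where
  "ldp_speed n \<equiv> real n / sqrt (ln (real n))"

lemma ldp_speed_at_top: "filterlim ldp_speed at_top sequentially"
  by real_asymp

lemma rescaled_coord_eq:
  assumes "2 \<le> n" and "k = sqrt (real n / ln (real n)) * m"
  shows "m = k * sqrt (ln (real n)) / sqrt (real n)"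
  using assms by (simp add: real_sqrt_divide)

text \<open>With \<open>s = (1 - d) / m n\<close> the linear term of the exponent is about
  \<open>(1 - d) * a / c\<close> times the speed, while \<open>s\<^sup>2 / d\<close> is of the
  smaller order \<open>n / ln n\<close>. Since only the moduli of the coordinates enter, the bound
  applies to \<open>- v\<close> as well.\<close>

lemma eventually_prob_tail_upper:
  fixes v :: "nat \<Rightarrow> nat \<Rightarrow> real" and a b c :: real
  assumes c: "0 < c" and lim: "(\<lambda>n. sqrt (real n / ln (real n)) * m n) \<longlonglongrightarrow> c"
    and X: "\<And>n. 1 \<le> n \<Longrightarrow> uniform_on_l1_ball n (M n) (X n)"
    and v: "\<And>n. 1 \<le> n \<Longrightarrow> (\<Sum>i\<in>{1..n}. (v n i)\<^sup>2) \<le> 1"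
    and m: "\<And>n i. i \<in> {1..n} \<Longrightarrow> \<bar>v n i\<bar> \<le> m n"
    and a: "0 < a" and b: "b < a / c"
  shows "\<forall>\<^sub>F n in sequentially.
    measure (M n) {\<omega> \<in> space (M n). a \<le> sqrt (real n) * (\<Sum>i\<in>{1..n}. X n \<omega> i * v n i)}
      \<le> exp (- b * ldp_speed n)"
proof -
  let ?k = "\<lambda>n. sqrt (real n / ln (real n)) * m n"
  \<comment> \<open>Replacing \<open>a\<close> by \<open>(1 - d) * a\<close> may use up at most half
    of the gap \<open>a - b * c\<close>, so the rate stays above \<open>b\<close>; the value
    \<open>1 / 2\<close> ensures \<open>d < 1\<close>.\<close>
  define d where "d = min (1 / 2) ((a / c - b) * c / (2 * a))"
  have d: "0 < d" "d < 1" using a b c by (auto simp: d_def)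
  have "d * a \<le> (a / c - b) * c / 2"
    using a by (simp add: d_def min_def field_simps)
  also have "\<dots> < (a / c - b) * c"
    using b c by (simp add: field_simps)
  also have "\<dots> = a - b * c"
    using c by (simp add: left_diff_distrib)
  finally have db: "b < (1 - d) * a / c"
    using c by (simp add: pos_less_divide_eq left_diff_distrib)
  \<comment> \<open>\<open>?D n\<close> is the exponent of the Chernoff bound for \<open>s = (1 - d) / m n\<close>, divided by the speed.\<close>
  let ?D = "\<lambda>n. (1 + ln (real n)) * sqrt (ln (real n)) / real n
    + (1 - d)\<^sup>2 / d * (1 / sqrt (ln (real n))) / (?k n)\<^sup>2 - (1 - d) * a / ?k n"
  have "(\<lambda>n. (1 + ln (real n)) * sqrt (ln (real n)) / real n) \<longlonglongrightarrow> 0"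
    by real_asymp
  moreover have "(\<lambda>n. 1 / sqrt (ln (real n))) \<longlonglongrightarrow> 0"
    by real_asymp
  ultimately have "?D \<longlonglongrightarrow> 0 + (1 - d)\<^sup>2 / d * 0 / c\<^sup>2 - (1 - d) * a / c"
    using c by (intro tendsto_intros lim) auto
  then have "?D \<longlonglongrightarrow> - ((1 - d) * a / c)" by simp
  then have "\<forall>\<^sub>F n in sequentially. ?D n < - b"
    using db by (intro order_tendstoD) auto
  moreover have "\<forall>\<^sub>F n in sequentially. 0 < ?k n"
    using c lim by (intro order_tendstoD)
  moreover have "\<forall>\<^sub>F n in sequentially. 2 \<le> n"
    by (rule eventually_ge_at_top)
  ultimately show ?thesis
  proof eventually_elim
    case (elim n)
    define k where "k = ?k n"
    define L where "L = sqrt (ln (real n))"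
    define R where "R = sqrt (real n)"
    define s where "s = (1 - d) / m n"
    have n1: "1 \<le> n" using elim by simp
    have "0 < ln (real n)" using elim by simp
    then have L: "0 < L" "L\<^sup>2 = ln (real n)" by (auto simp: L_def)
    have R: "0 < R" "R\<^sup>2 = real n" using elim by (auto simp: R_def)
    have k: "0 < k" using elim by (simp add: k_def)
    have mk: "m n = k * L / R"
      unfolding L_def R_def using elim by (intro rescaled_coord_eq) (auto simp: k_def)
    have m0: "0 < m n" unfolding mk using L R k by simp
    have s0: "0 \<le> s" using d m0 by (simp add: s_def)
    have sv: "(s * v n i)\<^sup>2 \<le> 1 - d" if "i \<in> {1..n}" for i
    proof -
      have "\<bar>s * v n i\<bar> \<le> s * m n"
        using m[OF that] s0 by (simp add: abs_mult mult_left_mono)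
      also have "\<dots> = 1 - d" using m0 by (simp add: s_def)
      finally have "\<bar>s * v n i\<bar>\<^sup>2 \<le> (1 - d)\<^sup>2" by (intro power_mono) auto
      also have "\<dots> \<le> 1 - d"
        using d by (simp add: power2_eq_square mult_left_le_one_le)
      finally show ?thesis by simp
    qed
    have "{\<omega> \<in> space (M n). a \<le> R * (\<Sum>i\<in>{1..n}. X n \<omega> i * v n i)}
        = {\<omega> \<in> space (M n). a / R \<le> (\<Sum>i\<in>{1..n}. X n \<omega> i * v n i)}"
      using R by (simp add: pos_divide_le_eq mult.commute)
    then have "measure (M n) {\<omega> \<in> space (M n). a \<le> R * (\<Sum>i\<in>{1..n}. X n \<omega> i * v n i)}
        \<le> exp 1 * real n * exp (s\<^sup>2 / d - real n * s * (a / R))"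
      using prob_tail_upper[OF X[OF n1] n1 v[OF n1] s0 d(1) sv, of "a / R"] by simp
    also have "\<dots> = exp (1 + ln (real n) + (s\<^sup>2 / d - real n * s * (a / R)))"
      using elim by (simp add: exp_add)
    \<comment> \<open>In terms of \<open>R = sqrt n\<close>, \<open>L = sqrt (ln n)\<close> and
      \<open>k\<close> the identity is purely rational.\<close>
    also have "1 + ln (real n) + (s\<^sup>2 / d - real n * s * (a / R))
        = (R\<^sup>2 / L) * ((1 + L\<^sup>2) * L / R\<^sup>2 + (1 - d)\<^sup>2 / d * (1 / L) / k\<^sup>2 - (1 - d) * a / k)"
      unfolding s_def mk L(2)[symmetric] unfolding R(2)[symmetric] using L(1) R(1) k d
      by (simp add: field_simps power2_eq_square)
    also have "\<dots> = ldp_speed n * ?D n"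
      unfolding k_def[symmetric] L(2) R(2) L_def[symmetric] ..
    also have "exp \<dots> \<le> exp (ldp_speed n * (- b))"
      using elim \<open>0 < ln (real n)\<close> by (intro iffD2[OF exp_le_cancel_iff] mult_left_mono) auto
    finally show ?case by (simp add: R_def mult.commute)
  qed
qed

text \<open>A coordinate of weight \<open>m n\<close> alone reaches the level \<open>w\<close> when
  it is at least \<open>y = w / (sqrt n * m n)\<close>, which is about
  \<open>w / (c * sqrt (ln n))\<close>. As \<open>y\<close> tends to 0, \<open>(1 - y) ^ n\<close>
  decays like \<open>exp (- n * y)\<close>, which has rate \<open>w / c\<close> at the given
  speed.\<close>

lemma eventually_prob_tail_lower:
  fixes v :: "nat \<Rightarrow> nat \<Rightarrow> real" and w b c :: real
  assumes c: "0 < c" and lim: "(\<lambda>n. sqrt (real n / ln (real n)) * m n) \<longlonglongrightarrow> c"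
    and X: "\<And>n. 1 \<le> n \<Longrightarrow> uniform_on_l1_ball n (M n) (X n)"
    and m: "\<And>n. 1 \<le> n \<Longrightarrow> \<exists>i\<in>{1..n}. \<bar>v n i\<bar> = m n"
    and w: "0 \<le> w" and b: "w / c < b"
  shows "\<forall>\<^sub>F n in sequentially. exp (- b * ldp_speed n)
    \<le> measure (M n) {\<omega> \<in> space (M n). w \<le> sqrt (real n) * (\<Sum>i\<in>{1..n}. X n \<omega> i * v n i)}"
proof -
  let ?k = "\<lambda>n. sqrt (real n / ln (real n)) * m n"
  let ?y = "\<lambda>n. w / ?k n * (1 / sqrt (ln (real n)))"
  \<comment> \<open>\<open>- ?D n\<close> bounds the logarithm of \<open>(1 - ?y n) ^ n / 4\<close>, divided by the speed, from below.\<close>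
  let ?D = "\<lambda>n. w / ?k n / (1 - ?y n) + ln 4 * (sqrt (ln (real n)) / real n)"
  have "(\<lambda>n. sqrt (ln (real n)) / real n) \<longlonglongrightarrow> 0"
    by real_asymp
  moreover have "(\<lambda>n. 1 / sqrt (ln (real n))) \<longlonglongrightarrow> 0"
    by real_asymp
  then have "?y \<longlonglongrightarrow> w / c * 0"
    using c by (intro tendsto_intros lim) auto
  then have y: "?y \<longlonglongrightarrow> 0" by simp
  ultimately have "?D \<longlonglongrightarrow> w / c / (1 - 0) + ln 4 * 0"
    using c by (intro tendsto_intros lim y) auto
  then have "\<forall>\<^sub>F n in sequentially. ?D n < b"
    using b by (intro order_tendstoD) auto
  moreover have "\<forall>\<^sub>F n in sequentially. 0 < ?k n"
    using c lim by (intro order_tendstoD)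
  moreover have "\<forall>\<^sub>F n in sequentially. ?y n < 1"
    using y by (intro order_tendstoD) auto
  moreover have "\<forall>\<^sub>F n in sequentially. 2 \<le> n"
    by (rule eventually_ge_at_top)
  ultimately show ?thesis
  proof eventually_elim
    case (elim n)
    define k where "k = ?k n"
    define L where "L = sqrt (ln (real n))"
    define R where "R = sqrt (real n)"
    define y where "y = w / k * (1 / L)"
    have "0 < ln (real n)" using elim by simp
    then have L: "0 < L" by (auto simp: L_def)
    have R: "0 < R" "R\<^sup>2 = real n" using elim by (auto simp: R_def)
    have k: "0 < k" using elim by (simp add: k_def)
    have mk: "m n = k * L / R"
      unfolding L_def R_def using elim by (intro rescaled_coord_eq) (auto simp: k_def)
    have y01: "0 \<le> y" "y < 1"
      using elim w L k unfolding y_def k_def L_def by auto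
    obtain i where i: "i \<in> {1..n}" "\<bar>v n i\<bar> = m n"
      using m[of n] elim by auto
    have "w = R * (y * m n)"
      unfolding y_def mk using L R k by (simp add: field_simps)
    then have "{\<omega> \<in> space (M n). w \<le> R * (\<Sum>i\<in>{1..n}. X n \<omega> i * v n i)}
        = {\<omega> \<in> space (M n). y * \<bar>v n i\<bar> \<le> (\<Sum>i\<in>{1..n}. X n \<omega> i * v n i)}"
      using R(1) i(2) by simp
    then have tail: "(1 - y) ^ n / 4
        \<le> measure (M n) {\<omega> \<in> space (M n). w \<le> R * (\<Sum>i\<in>{1..n}. X n \<omega> i * v n i)}"
      using prob_tail_lower[OF X i(1) y01(1), of "v n"] y01 elim by simp
    have "exp (- b * ldp_speed n) \<le> exp (- ?D n * ldp_speed n)"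
      using elim \<open>0 < ln (real n)\<close> by (intro iffD2[OF exp_le_cancel_iff] mult_right_mono) auto
    also have "- ?D n * ldp_speed n = - (y * L / (1 - y) + ln 4 * (L / real n)) * (real n / L)"
      using L unfolding k_def[symmetric] L_def[symmetric] y_def by simp
    also have "\<dots> = real n * (- (y / (1 - y))) - ln 4"
      using L elim y01(2) by (simp add: field_simps)
    also have "exp \<dots> = exp (- (y / (1 - y))) ^ n / 4"
      by (simp only: exp_diff exp_of_nat_mult exp_ln zero_less_numeral)
    also have "\<dots> \<le> (1 - y) ^ n / 4"
    proof (intro divide_right_mono power_mono)
      \<comment> \<open>The reciprocal of \<open>inverse_one_minus_le_exp\<close> with gap
        \<open>1 - y\<close>.\<close>
      show "exp (- (y / (1 - y))) \<le> 1 - y"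
        using inverse_one_minus_le_exp[of y "1 - y"] y01 by (simp add: exp_minus field_simps)
    qed auto
    also note tail
    finally show ?case by (simp add: R_def)
  qed
qed

lemma borel_measurable_uniform_on_l1_ball:
  assumes "uniform_on_l1_ball n M X"
  shows "(\<lambda>\<omega>. \<Sum>i\<in>{1..n}. X \<omega> i * v i) \<in> borel_measurable M"
proof -
  have "(\<lambda>x. \<Sum>i\<in>{1..n}. x i * v i) \<in> borel_measurable (lebesgue_prod {1..n})"
    by measurable
  moreover have "X \<in> M \<rightarrow>\<^sub>M lebesgue_prod {1..n}"
    using assms by (simp add: uniform_on_l1_ball_def)
  ultimately show ?thesis
    by (rule measurable_compose[rotated])
qed

text \<open>Lets any positive gap between two rates absorb a constant factor in the
  probabilities.\<close>

lemma eventually_le_speed: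
  assumes "0 < d"
  shows "\<forall>\<^sub>F n in sequentially. B \<le> d * ldp_speed n"
proof -
  have "\<forall>\<^sub>F n in sequentially. B / d \<le> ldp_speed n"
    using ldp_speed_at_top by (simp add: filterlim_at_top)
  then show ?thesis
    by eventually_elim (use assms in \<open>simp add: pos_divide_le_eq mult.commute\<close>)
qed

text \<open>The tail beyond \<open>w + \<delta>\<close> has a strictly larger rate than the tail
  beyond \<open>w\<close>, so removing it leaves most of the mass.\<close>

lemma eventually_prob_window_lower:
  fixes v :: "nat \<Rightarrow> nat \<Rightarrow> real" and w b c \<delta> :: real
  assumes c: "0 < c" and lim: "(\<lambda>n. sqrt (real n / ln (real n)) * m n) \<longlonglongrightarrow> c"
    and M: "\<And>n. 1 \<le> n \<Longrightarrow> prob_space (M n)"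
    and X: "\<And>n. 1 \<le> n \<Longrightarrow> uniform_on_l1_ball n (M n) (X n)"
    and v: "\<And>n. 1 \<le> n \<Longrightarrow> (\<Sum>i\<in>{1..n}. (v n i)\<^sup>2) \<le> 1"
    and m: "\<And>n i. i \<in> {1..n} \<Longrightarrow> \<bar>v n i\<bar> \<le> m n" "\<And>n. 1 \<le> n \<Longrightarrow> \<exists>i\<in>{1..n}. \<bar>v n i\<bar> = m n"
    and w: "0 \<le> w" and \<delta>: "0 < \<delta>" and b: "w / c < b"
  shows "\<forall>\<^sub>F n in sequentially. exp (- b * ldp_speed n)
    \<le> measure (M n) {\<omega> \<in> space (M n).
        sqrt (real n) * (\<Sum>i\<in>{1..n}. X n \<omega> i * v n i) \<in> {w..<w + \<delta>}}"
proof -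
  \<comment> \<open>The rates satisfy \<open>w / c < b1 < b2 < b\<close> and
    \<open>b2 < (w + \<delta>) / c\<close>. Eventually the tail at \<open>w\<close> is at least
    \<open>2 * exp (- b2 * ldp_speed n)\<close> and the tail at \<open>w + \<delta>\<close> at most
    half of that.\<close>
  have "w / c < min b ((w + \<delta>) / c)"
    using b \<delta> c by (simp add: divide_strict_right_mono)
  then obtain b2 where b2: "w / c < b2" "b2 < min b ((w + \<delta>) / c)"
    using dense by blast
  obtain b1 where b1: "w / c < b1" "b1 < b2"
    using dense[OF b2(1)] by blast
  have "\<forall>\<^sub>F n in sequentially. exp (- b1 * ldp_speed n)
    \<le> measure (M n) {\<omega> \<in> space (M n). w \<le> sqrt (real n) * (\<Sum>i\<in>{1..n}. X n \<omega> i * v n i)}"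
    by (rule eventually_prob_tail_lower[OF c lim X m(2) w b1(1)])
  moreover have "\<forall>\<^sub>F n in sequentially.
    measure (M n) {\<omega> \<in> space (M n). w + \<delta> \<le> sqrt (real n) * (\<Sum>i\<in>{1..n}. X n \<omega> i * v n i)}
      \<le> exp (- b2 * ldp_speed n)"
    using w \<delta> b2 by (intro eventually_prob_tail_upper[OF c lim X v m(1)]) auto
  moreover have "\<forall>\<^sub>F n in sequentially. ln 2 \<le> (b2 - b1) * ldp_speed n"
    using b1 by (intro eventually_le_speed) auto
  moreover have "\<forall>\<^sub>F n in sequentially. 0 \<le> (b - b2) * ldp_speed n"
    using b2 by (intro eventually_le_speed) auto
  moreover have "\<forall>\<^sub>F n::nat in sequentially. 1 \<le> n"
    by (rule eventually_ge_at_top)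
  ultimately show ?thesis
  proof eventually_elim
    case (elim n)
    let ?Z = "\<lambda>\<omega>. sqrt (real n) * (\<Sum>i\<in>{1..n}. X n \<omega> i * v n i)"
    interpret prob_space "M n" by (rule M) fact
    note [measurable] = borel_measurable_uniform_on_l1_ball[OF X[OF elim(5)]]
    have "{\<omega> \<in> space (M n). w \<le> ?Z \<omega>}
        = {\<omega> \<in> space (M n). ?Z \<omega> \<in> {w..<w + \<delta>}} \<union> {\<omega> \<in> space (M n). w + \<delta> \<le> ?Z \<omega>}"
      using \<delta> by auto
    then have "measure (M n) {\<omega> \<in> space (M n). w \<le> ?Z \<omega>}
        \<le> measure (M n) {\<omega> \<in> space (M n). ?Z \<omega> \<in> {w..<w + \<delta>}}
          + measure (M n) {\<omega> \<in> space (M n). w + \<delta> \<le> ?Z \<omega>}"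
      by (simp only:) (intro measure_Un_le; measurable)
    moreover have "2 * exp (- b2 * ldp_speed n) = exp (ln 2 + - b2 * ldp_speed n)"
      by (simp only: exp_add exp_ln zero_less_numeral)
    then have "2 * exp (- b2 * ldp_speed n) \<le> exp (- b1 * ldp_speed n)"
      using elim(3) by (simp only: exp_le_cancel_iff left_diff_distrib; linarith)
    moreover have "exp (- b * ldp_speed n) \<le> exp (- b2 * ldp_speed n)"
      using elim(4) by (simp only: exp_le_cancel_iff left_diff_distrib; linarith)
    ultimately show ?case using elim(1,2) by linarith
  qed
qed

section \<open>From probability bounds to extended-real rates\<close>

lemma scaled_ln_prob_le:
  assumes "0 < s" "0 \<le> p" "p \<le> exp (- b * s)"
  shows "ereal (1 / s) * ln_prob p \<le> ereal (- b)"
proof -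
  have "ln_prob p \<le> ereal (- b * s)"
    using assms ln_le_cancel_iff[of p "exp (- b * s)"] by (auto simp: ln_prob_def)
  then have "ereal (1 / s) * ln_prob p \<le> ereal (1 / s) * ereal (- b * s)"
    using assms by (intro ereal_mult_left_mono) auto
  then show ?thesis using assms by simp
qed

lemma scaled_ln_prob_ge:
  assumes "0 < s" "exp (- b * s) \<le> p"
  shows "ereal (- b) \<le> ereal (1 / s) * ln_prob p"
proof -
  have p: "0 < p" using assms(2) exp_gt_zero less_le_trans by blast
  then have "ereal (- b * s) \<le> ln_prob p"
    using assms ln_le_cancel_iff[of "exp (- b * s)" p] by (auto simp: ln_prob_def)
  then have "ereal (1 / s) * ereal (- b * s) \<le> ereal (1 / s) * ln_prob p"
    using assms by (intro ereal_mult_left_mono) auto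
  then show ?thesis using assms by simp
qed

lemma ln_prob_mono: "0 \<le> p \<Longrightarrow> p \<le> q \<Longrightarrow> ln_prob p \<le> ln_prob q"
  by (auto simp: ln_prob_def)

lemma abs_le_max_abs_coord: "i \<in> {1..n} \<Longrightarrow> \<bar>x i\<bar> \<le> max_abs_coord n x"
  unfolding max_abs_coord_def by (intro Max_ge) auto

lemma max_abs_coord_attained: "1 \<le> n \<Longrightarrow> \<exists>i\<in>{1..n}. \<bar>x i\<bar> = max_abs_coord n x"
  using Max_in[of "(\<lambda>i. \<bar>x i\<bar>) ` {1..n}"] unfolding max_abs_coord_def by fastforce

lemma unit_sphere_sum_squares: "x \<in> unit_sphere n \<Longrightarrow> (\<Sum>i\<in>{1..n}. (x i)\<^sup>2) = 1"
  by (simp add: unit_sphere_def L2_set_def)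

lemma eventually_speed_pos: "\<forall>\<^sub>F n in sequentially. 0 < ldp_speed n"
  using ldp_speed_at_top unfolding filterlim_at_top_dense by blast

lemma good_rate_I_qu:
  assumes "0 < c"
  shows "good_rate (I_qu c)"
proof -
  have "{x. I_qu c x \<le> ereal a} = cball 0 (a * c)" for a
    using assms by (auto simp: I_qu_def pos_divide_le_eq)
  then show ?thesis by (simp add: good_rate_def)
qed

lemma lower_semicont_I_qu:
  assumes "0 < c"
  shows "lower_semicont (I_qu c)"
  unfolding lower_semicont_def
proof
  fix a :: ereal
  show "closed {x. I_qu c x \<le> a}"
    unfolding I_qu_def using assms by (intro closed_Collect_le continuous_intros) auto
qed

section \<open>Assembly of the large deviation principle\<close>

theorem theorem2p6:
  fixes c :: real
    and \<theta> :: "nat \<Rightarrow> nat \<Rightarrow> real"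
    and M :: "nat \<Rightarrow> 'a measure"
    and X :: "nat \<Rightarrow> 'a \<Rightarrow> nat \<Rightarrow> real"
  assumes "c > 0"
    and "\<And>n. n \<ge> 1 \<Longrightarrow> \<theta> n \<in> unit_sphere n"
    and "(\<lambda>n. sqrt (real n / ln (real n)) * max_abs_coord n (\<theta> n)) \<longlonglongrightarrow> c"
    and "\<And>n. n \<ge> 1 \<Longrightarrow> prob_space (M n)"
    and "\<And>n. n \<ge> 1 \<Longrightarrow> uniform_on_l1_ball n (M n) (X n)"
  shows "satisfies_LDP M (W_proj \<theta> X) (\<lambda>n. real n / sqrt (ln (real n))) (I_qu c)
         \<and> good_rate (I_qu c)"
proof -
  let ?m = "\<lambda>n. max_abs_coord n (\<theta> n)"
  let ?W = "W_proj \<theta> X"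
  let ?I = "I_qu c"
  let ?P = "\<lambda>n A. measure (M n) {\<omega> \<in> space (M n). ?W n \<omega> \<in> A}"
  let ?L = "\<lambda>A n. ereal (1 / ldp_speed n) * ln_prob (?P n A)"
  note c = assms(1) and lim = assms(3) and M = assms(4) and X = assms(5)
  have W: "?W n \<omega> = sqrt (real n) * (\<Sum>i\<in>{1..n}. X n \<omega> i * \<theta> n i)" for n \<omega>
    by (simp add: W_proj_def)
  \<comment> \<open>The left tail of the projection is the right tail for the direction
    \<open>- \<theta> n\<close>.\<close>
  have minus_W: "- ?W n \<omega> = sqrt (real n) * (\<Sum>i\<in>{1..n}. X n \<omega> i * - \<theta> n i)" for n \<omega>
    by (simp add: W_proj_def sum_negf)
  have W_meas: "?W n \<in> borel_measurable (M n)" if "1 \<le> n" for n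
    using borel_measurable_uniform_on_l1_ball[OF X[OF that], of "\<theta> n"]
    unfolding W by measurable
  have W_event: "{\<omega> \<in> space (M n). ?W n \<omega> \<in> A} \<in> sets (M n)"
    if "1 \<le> n" "A \<in> sets borel" for n A
    using measurable_sets[OF W_meas[OF that(1)] that(2)] by (simp add: vimage_def Int_def conj_commute)
  have \<theta>_sq: "(\<Sum>i\<in>{1..n}. (\<theta> n i)\<^sup>2) \<le> 1" if "1 \<le> n" for n
    using unit_sphere_sum_squares[OF assms(2)[OF that]] by simp
  have \<theta>_max: "\<bar>\<theta> n i\<bar> \<le> ?m n" if "i \<in> {1..n}" for n i
    using that by (rule abs_le_max_abs_coord)
  have \<theta>_att: "\<exists>i\<in>{1..n}. \<bar>\<theta> n i\<bar> = ?m n" if "1 \<le> n" for n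
    using that by (rule max_abs_coord_attained)
  have n1: "\<forall>\<^sub>F n::nat in sequentially. 1 \<le> n"
    by (rule eventually_ge_at_top)

  have upper_prob: "\<forall>\<^sub>F n in sequentially. ?P n F \<le> exp (- b * ldp_speed n)"
    if F: "closed F" and b: "ereal b < (INF x\<in>F. ?I x)" for F b
  proof (cases "b \<le> 0")
    \<comment> \<open>For \<open>b \<le> 0\<close> the right-hand side is at least 1.\<close>
    case True
    show ?thesis
      using eventually_speed_pos n1
    proof eventually_elim
      case (elim n)
      interpret prob_space "M n" by (rule M) fact
      have "?P n F \<le> 1" by simp
      moreover have "0 \<le> - b * ldp_speed n"
        using True elim by (intro mult_nonneg_nonneg) auto
      then have "1 \<le> exp (- b * ldp_speed n)"
        by (simp only: one_le_exp_iff)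
      ultimately show ?case by linarith
    qed
  next
    case False
    \<comment> \<open>The rate \<open>b'\<close> keeps \<open>F\<close> outside the interval
      \<open>(-a, a)\<close> with \<open>a = b' * c\<close>. The midpoint \<open>b''\<close> lies
      below \<open>a / c\<close>, as the tail bound requires, and above \<open>b\<close>, which
      leaves room for the factor 2 from the two tails.\<close>
    obtain b' where b': "ereal b < ereal b'" "ereal b' < (INF x\<in>F. ?I x)"
      using ereal_dense2[OF b] by blast
    define a where "a = b' * c"
    define b'' where "b'' = (b + b') / 2"
    have a: "0 < a" using False b' c by (simp add: a_def)
    have b'': "b'' < a / c" "b < b''" using b' c by (auto simp: a_def b''_def)
    have aF: "a \<le> \<bar>x\<bar>" if "x \<in> F" for x
    proof -
      have "ereal b' < ?I x" using b'(2) INF_lower[OF that, of ?I] by (rule less_le_trans)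
      then show ?thesis using c by (simp add: I_qu_def a_def pos_less_divide_eq)
    qed
    have "\<forall>\<^sub>F n in sequentially. measure (M n) {\<omega> \<in> space (M n). a \<le> ?W n \<omega>} \<le> exp (- b'' * ldp_speed n)"
      unfolding W by (rule eventually_prob_tail_upper[OF c lim X \<theta>_sq \<theta>_max a b''(1)])
    moreover have "\<forall>\<^sub>F n in sequentially. measure (M n) {\<omega> \<in> space (M n). a \<le> - ?W n \<omega>} \<le> exp (- b'' * ldp_speed n)"
      unfolding minus_W
      by (rule eventually_prob_tail_upper[OF c lim X _ _ a b''(1)]) (use \<theta>_sq \<theta>_max in auto)
    moreover have "\<forall>\<^sub>F n in sequentially. ln 2 \<le> (b'' - b) * ldp_speed n"
      using b'' by (intro eventually_le_speed) auto
    ultimately show ?thesis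
      using n1
    proof eventually_elim
      case (elim n)
      interpret prob_space "M n" by (rule M) fact
      note [measurable] = W_meas[OF elim(4)]
      have tails: "{\<omega> \<in> space (M n). a \<le> ?W n \<omega>} \<in> sets (M n)"
        "{\<omega> \<in> space (M n). a \<le> - ?W n \<omega>} \<in> sets (M n)"
        by measurable
      have "?P n F \<le> measure (M n) ({\<omega> \<in> space (M n). a \<le> ?W n \<omega>} \<union> {\<omega> \<in> space (M n). a \<le> - ?W n \<omega>})"
      proof (rule finite_measure_mono)
        show "{\<omega> \<in> space (M n). ?W n \<omega> \<in> F}
            \<subseteq> {\<omega> \<in> space (M n). a \<le> ?W n \<omega>} \<union> {\<omega> \<in> space (M n). a \<le> - ?W n \<omega>}"
          by (auto simp: abs_real_def split: if_splits dest!: aF)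
      qed (use tails in blast)
      also have "\<dots> \<le> measure (M n) {\<omega> \<in> space (M n). a \<le> ?W n \<omega>} + measure (M n) {\<omega> \<in> space (M n). a \<le> - ?W n \<omega>}"
        using tails by (rule measure_Un_le)
      also have "\<dots> \<le> 2 * exp (- b'' * ldp_speed n)"
        using elim(1,2) by linarith
      also have "\<dots> = exp (ln 2 + - b'' * ldp_speed n)"
        by (simp only: exp_add exp_ln zero_less_numeral)
      also have "\<dots> \<le> exp (- b * ldp_speed n)"
        using elim(3) by (simp only: exp_le_cancel_iff left_diff_distrib; linarith)
      finally show ?case .
    qed
  qed

  have upper: "limsup (?L F) \<le> - (INF x\<in>F. ?I x)" if F: "closed F" for F
  proof -
    \<comment> \<open>Testing against every \<open>z\<close> strictly below the infimum also covers
      an empty \<open>F\<close>, whose infimum is \<infinity>; only real \<open>z\<close> need an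
      argument.\<close>
    have "(INF x\<in>F. ?I x) \<le> - limsup (?L F)"
    proof (rule dense_le)
      fix z assume z: "z < (INF x\<in>F. ?I x)"
      show "z \<le> - limsup (?L F)"
      proof (cases z)
        case (real b)
        have "limsup (?L F) \<le> ereal (- b)"
        proof (rule Limsup_bounded)
          show "\<forall>\<^sub>F n in sequentially. ?L F n \<le> ereal (- b)"
            using upper_prob[OF F z[unfolded real]] eventually_speed_pos
            by eventually_elim (intro scaled_ln_prob_le measure_nonneg)
        qed
        then have "- ereal (- b) \<le> - limsup (?L F)"
          by (simp only: ereal_minus_le_minus)
        then show ?thesis using real by simp
      qed (use z in auto)
    qed
    then have "- (- limsup (?L F)) \<le> - (INF x\<in>F. ?I x)"
      by (simp only: ereal_minus_le_minus)
    then show ?thesis by simp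
  qed

  have lower_prob: "\<forall>\<^sub>F n in sequentially. exp (- b * ldp_speed n) \<le> ?P n G"
    if G: "open G" "w \<in> G" and b: "\<bar>w\<bar> / c < b" for G w b
  proof -
    obtain \<delta> where \<delta>: "0 < \<delta>" "ball w \<delta> \<subseteq> G"
      using G open_contains_ball by blast
    have in_G: "x \<in> G" if "\<bar>x - w\<bar> < \<delta>" for x
      using \<delta>(2) that by (auto simp: dist_real_def abs_minus_commute)
    \<comment> \<open>Reflecting by the sign of \<open>w\<close> reduces to a nonnegative target.
      The window extends away from 0, so its rate is governed by its endpoint
      \<open>\<bar>w\<bar>\<close>.\<close>
    define \<sigma> :: real where "\<sigma> = (if 0 \<le> w then 1 else - 1)"
    have \<sigma>: "\<bar>\<sigma>\<bar> = 1" "\<sigma>\<^sup>2 = 1" by (auto simp: \<sigma>_def)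
    have \<sigma>W: "\<sigma> * ?W n \<omega> = sqrt (real n) * (\<Sum>i\<in>{1..n}. X n \<omega> i * (\<sigma> * \<theta> n i))" for n \<omega>
      by (simp add: W_proj_def sum_distrib_left ac_simps)
    have "\<forall>\<^sub>F n in sequentially. exp (- b * ldp_speed n)
        \<le> measure (M n) {\<omega> \<in> space (M n). \<sigma> * ?W n \<omega> \<in> {\<bar>w\<bar>..<\<bar>w\<bar> + \<delta>}}"
      unfolding \<sigma>W
      by (rule eventually_prob_window_lower[OF c lim M X _ _ _ _ \<delta>(1) b])
         (use \<theta>_sq \<theta>_max \<theta>_att \<sigma> in \<open>auto simp: power_mult_distrib abs_mult\<close>)
    then show ?thesis
      using n1
    proof eventually_elim
      case (elim n)
      interpret prob_space "M n" by (rule M) fact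
      have "measure (M n) {\<omega> \<in> space (M n). \<sigma> * ?W n \<omega> \<in> {\<bar>w\<bar>..<\<bar>w\<bar> + \<delta>}} \<le> ?P n G"
      proof (rule finite_measure_mono)
        show "{\<omega> \<in> space (M n). \<sigma> * ?W n \<omega> \<in> {\<bar>w\<bar>..<\<bar>w\<bar> + \<delta>}} \<subseteq> {\<omega> \<in> space (M n). ?W n \<omega> \<in> G}"
          using \<delta>(1) by (auto simp: \<sigma>_def intro!: in_G split: if_splits)
        show "{\<omega> \<in> space (M n). ?W n \<omega> \<in> G} \<in> sets (M n)"
          using G(1) elim(2) by (intro W_event) auto
      qed
      with elim(1) show ?case by linarith
    qed
  qed

  have lower: "- (INF x\<in>G. ?I x) \<le> liminf (?L G)" if G: "open G" for G
  proof -
    have "- liminf (?L G) \<le> (INF x\<in>G. ?I x)"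
    \<comment> \<open>Each point \<open>w\<close> of \<open>G\<close> is treated separately, with a
      real \<open>b\<close> strictly above its rate as \<open>lower_prob\<close> demands.\<close>
    proof (rule INF_greatest, rule dense_ge)
      fix w z assume w: "w \<in> G" and z: "?I w < z"
      show "- liminf (?L G) \<le> z"
      proof (cases z)
        case (real b)
        have "\<bar>w\<bar> / c < b" using z real by (simp add: I_qu_def)
        have "ereal (- b) \<le> liminf (?L G)"
        proof (rule Liminf_bounded)
          show "\<forall>\<^sub>F n in sequentially. ereal (- b) \<le> ?L G n"
            using lower_prob[OF G w \<open>\<bar>w\<bar> / c < b\<close>] eventually_speed_pos
            by eventually_elim (intro scaled_ln_prob_ge)
        qed
        then have "- liminf (?L G) \<le> - ereal (- b)"
          by (simp only: ereal_minus_le_minus)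
        then show ?thesis using real by simp
      qed (use z in auto)
    qed
    then have "- (INF x\<in>G. ?I x) \<le> - (- liminf (?L G))"
      by (simp only: ereal_minus_le_minus)
    then show ?thesis by simp
  qed

  \<comment> \<open>The chain is \<open>liminf\<close> over \<open>A\<close>, then
    \<open>limsup\<close> over \<open>A\<close>, then \<open>limsup\<close> over \<open>B\<close> by
    monotonicity; closedness of \<open>B\<close> supplies its measurability.\<close>
  have mid: "liminf (?L A) \<le> limsup (?L B)" if AB: "A \<subseteq> B" "closed B" for A B
  proof -
    have "\<forall>\<^sub>F n in sequentially. ?L A n \<le> ?L B n"
      using eventually_speed_pos n1
    proof eventually_elim
      case (elim n)
      interpret prob_space "M n" by (rule M) fact
      have "?P n A \<le> ?P n B"
        using AB elim(2) by (intro finite_measure_mono W_event) auto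
      then show ?case
        using elim(2) by (intro ereal_mult_left_mono ln_prob_mono) (auto intro: divide_nonneg_nonneg)
    qed
    then have "limsup (?L A) \<le> limsup (?L B)" by (rule Limsup_mono)
    then show ?thesis
      using Liminf_le_Limsup[of sequentially "?L A"] by (auto intro: order_trans)
  qed

  have "satisfies_LDP M ?W ldp_speed ?I"
    unfolding satisfies_LDP_def
  proof (intro conjI allI impI ballI)
    fix \<Gamma> :: "real set"
    show "liminf (?L (interior \<Gamma>)) \<le> limsup (?L (closure \<Gamma>))"
      using interior_subset closure_subset by (intro mid) (blast, simp)
    show "- (INF x\<in>interior \<Gamma>. ?I x) \<le> liminf (?L (interior \<Gamma>))"
      by (rule lower) simp
    show "limsup (?L (closure \<Gamma>)) \<le> - (INF x\<in>closure \<Gamma>. ?I x)"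
      by (rule upper) simp
    show "0 \<le> ?I x" for x
      using c by (simp add: I_qu_def)
  qed (use M W_meas lower_semicont_I_qu[OF c] in auto)
  then show ?thesis
    using good_rate_I_qu[OF c] by simp
qed

end
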